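(* Let $\Delta:\mathbb{M}_2(\mathbb{C})\to \mathbb{M}_2(\mathbb{C})\otimes\mathbb{M}_2(\mathbb{C})$ be a quantum quadratic operator for which the normalized trace $\tau$ is a Haar state, so that $\Delta(\sigma_j)=\sum_{m,l=1}^3 b_{ml,j}\,\sigma_m\otimes\sigma_l$ ($j=1,2,3$) with real coefficients $b_{ml,j}$. For $\mathbf f=(f_1,f_2,f_3)\in\mathbb{R}^3$ let $\mathbb{B}(\mathbf f)=(\beta(\mathbf f)_{ij})_{i,j=1}^3$ be the real $3\times 3$ matrix with entries $\beta(\mathbf f)_{ij}=\sum_{k=1}^3 b_{ki,j}f_k$. Then $$|||\mathbb{B}|||:=\sup_{\mathbf f\in S}\|\mathbb{B}(\mathbf f)\|\le 1 .$$
   Context: A linear map $\Delta:\mathbb{M}_2(\mathbb{C})\to \mathbb{M}_2(\mathbb{C})\otimes\mathbb{M}_2(\mathbb{C})$ is a quantum quadratic operator (q.q.o.) if $\Delta\mathbf 1=\mathbf 1\otimes\mathbf 1$ (with $\mathbf 1$ the identity matrix) and $\Delta x\ge0$ whenever $x\ge 0$. A state $h$ is a Haar state for $\Delta$ if $(h\otimes id)\circ\Delta(x)=(id\otimes h)\circ\Delta(x)=h(x)\mathbf 1$ for all $x\in\mathbb{M}_2(\mathbb{C})$. $\tau(x)=\frac12\mathrm{Tr}(x)$. The Pauli matrices are $\sigma_1=\begin{pmatrix}0&1\\1&0\end{pmatrix}$, $\sigma_2=\begin{pmatrix}0&-i\\ i&0\end{pmatrix}$, $\sigma_3=\begin{pmatrix}1&0\\0&-1\end{pmatrix}$.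 Every q.q.o. with Haar state $\tau$ has the displayed form on the Pauli matrices, with real coefficients. $S=\{\mathbf p\in\mathbb{R}^3: p_1^2+p_2^2+p_3^2\le 1\}$ is the closed unit ball, and $\|\mathbb{B}(\mathbf f)\|$ is the operator norm associated with the Euclidean norm on $\mathbb{R}^3$. *)

theory Defs
  imports "HOL-Analysis.Analysis"
begin

type_synonym m2 = "complex^2^2"

(* M_2(C) \<otimes> M_2(C), realised as the 4 x 4 matrices with rows and columns indexed by pairs;
   the elementary tensors are the Kronecker products kron A B. *)
type_synonym m2m2 = "complex^(2 \<times> 2)^(2 \<times> 2)"

(* Complex scalar multiplication of matrices (the library's scaleR on this type is only real). *)
definition cscale :: "complex \<Rightarrow> complex^'n^'m \<Rightarrow> complex^'n^'m" where
  "cscale c A = (\<chi> i j. c * A $ i $ j)"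

definition kron :: "complex^'n^'m \<Rightarrow> complex^'q^'p \<Rightarrow> complex^('n \<times> 'q)^('m \<times> 'p)" where
  "kron A B = (\<chi> i j. A $ fst i $ fst j * B $ snd i $ snd j)"

(* Positivity x \<ge> 0: \<langle>v, A v\<rangle> is a nonnegative real for all complex v (so A is Hermitian). *)
definition psd :: "complex^'n^'n \<Rightarrow> bool" where
  "psd A \<longleftrightarrow> (\<forall>v. (\<Sum>i\<in>UNIV. cnj (v $ i) * (A *v v) $ i) \<in> \<real>\<^sub>\<ge>\<^sub>0)"

definition qqo :: "(m2 \<Rightarrow> m2m2) \<Rightarrow> bool" where
  "qqo \<Delta> \<longleftrightarrow> Vector_Spaces.linear cscale cscale \<Delta> \<and>
     \<Delta> (mat 1) = kron (mat 1) (mat 1) \<and> (\<forall>x. psd x \<longrightarrow> psd (\<Delta> x))"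

definition state :: "(m2 \<Rightarrow> complex) \<Rightarrow> bool" where
  "state h \<longleftrightarrow> Vector_Spaces.linear cscale (*) h \<and> h (mat 1) = 1 \<and>
     (\<forall>x. psd x \<longrightarrow> h x \<in> \<real>\<^sub>\<ge>\<^sub>0)"

definition unit_mat :: "2 \<Rightarrow> 2 \<Rightarrow> m2" where
  "unit_mat i j = (\<chi> k l. if k = i \<and> l = j then 1 else 0)"

(* h \<otimes> id and id \<otimes> h, obtained by expanding X in matrix units of the factor on which h acts;
   slice1_kron and slice2_kron below give their values on elementary tensors. *)
definition slice1 :: "(m2 \<Rightarrow> complex) \<Rightarrow> m2m2 \<Rightarrow> m2" where
  "slice1 h X = (\<Sum>i\<in>UNIV. \<Sum>j\<in>UNIV. cscale (h (unit_mat i j)) (\<chi> k l. X $ (i, k) $ (j, l)))"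

definition slice2 :: "(m2 \<Rightarrow> complex) \<Rightarrow> m2m2 \<Rightarrow> m2" where
  "slice2 h X = (\<Sum>i\<in>UNIV. \<Sum>j\<in>UNIV. cscale (h (unit_mat i j)) (\<chi> k l. X $ (k, i) $ (l, j)))"

definition haar_state :: "(m2 \<Rightarrow> complex) \<Rightarrow> (m2 \<Rightarrow> m2m2) \<Rightarrow> bool" where
  "haar_state h \<Delta> \<longleftrightarrow> state h \<and>
     (\<forall>x. slice1 h (\<Delta> x) = cscale (h x) (mat 1) \<and> slice2 h (\<Delta> x) = cscale (h x) (mat 1))"

definition \<tau> :: "m2 \<Rightarrow> complex" where
  "\<tau> x = trace x / 2"

(* The numeral type 3 has the elements 1, 2 and 3 (= 0). *)
definition pauli :: "3 \<Rightarrow> m2" where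
  "pauli j =
     (if j = 1 then vector [vector [0, 1], vector [1, 0]]
      else if j = 2 then vector [vector [0, - \<i>], vector [\<i>, 0]]
      else vector [vector [1, 0], vector [0, - 1]])"

(* b m l j is the coefficient b_{ml,j}. *)
definition pauli_form :: "(m2 \<Rightarrow> m2m2) \<Rightarrow> (3 \<Rightarrow> 3 \<Rightarrow> 3 \<Rightarrow> real) \<Rightarrow> bool" where
  "pauli_form \<Delta> b \<longleftrightarrow>
     (\<forall>j. \<Delta> (pauli j) =
        (\<Sum>m\<in>UNIV. \<Sum>l\<in>UNIV. cscale (complex_of_real (b m l j)) (kron (pauli m) (pauli l))))"

definition Bmat :: "(3 \<Rightarrow> 3 \<Rightarrow> 3 \<Rightarrow> real) \<Rightarrow> real^3 \<Rightarrow> real^3^3" where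
  "Bmat b f = (\<chi> i j. \<Sum>k\<in>UNIV. b k i j * f $ k)"

definition S :: "(real^3) set" where
  "S = {p. (p $ 1)\<^sup>2 + (p $ 2)\<^sup>2 + (p $ 3)\<^sup>2 \<le> 1}"

definition Bnorm :: "(3 \<Rightarrow> 3 \<Rightarrow> 3 \<Rightarrow> real) \<Rightarrow> real" where
  "Bnorm b = (SUP f\<in>S. onorm (\<lambda>v. Bmat b f *v v))"

lemma vector_space_cscale: "vector_space cscale"
  by unfold_locales (auto simp: cscale_def vec_eq_iff algebra_simps)

lemma unit_mat_expand: "a = (\<Sum>i\<in>UNIV. \<Sum>j\<in>UNIV. cscale (a $ i $ j) (unit_mat i j))"
  by (simp add: vec_eq_iff cscale_def unit_mat_def sum_2 forall_2)

lemma linear_functional_expand: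
  assumes "Vector_Spaces.linear cscale (*) h"
  shows "h a = (\<Sum>i\<in>UNIV. \<Sum>j\<in>UNIV. a $ i $ j * h (unit_mat i j))"
proof -
  interpret Vector_Spaces.linear cscale "(*)" h by fact
  show ?thesis by (subst unit_mat_expand[of a]) (simp add: sum scale)
qed

lemma slice1_kron:
  assumes "Vector_Spaces.linear cscale (*) h"
  shows "slice1 h (kron a b) = cscale (h a) b"
  unfolding slice1_def linear_functional_expand[OF assms, of a]
  by (simp add: vec_eq_iff cscale_def kron_def sum_2 algebra_simps)

lemma slice2_kron:
  assumes "Vector_Spaces.linear cscale (*) h"
  shows "slice2 h (kron a b) = cscale (h b) a"
  unfolding slice2_def linear_functional_expand[OF assms, of b]
  by (simp add: vec_eq_iff cscale_def kron_def sum_2 algebra_simps)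

lemma psd_diag:
  assumes "psd A" shows "A $ k $ k \<in> \<real>\<^sub>\<ge>\<^sub>0"
proof -
  have "(\<Sum>i\<in>UNIV. cnj (axis k 1 $ i) * (A *v axis k 1) $ i) \<in> \<real>\<^sub>\<ge>\<^sub>0"
    using assms unfolding psd_def by blast
  then show ?thesis
    by (simp add: axis_def matrix_vector_mult_def if_distrib if_distribR cong: if_cong)
qed

lemma state_tau: "state \<tau>"
proof -
  have "Vector_Spaces.linear cscale (*) \<tau>"
    by (auto simp: Vector_Spaces.linear_iff vector_space_cscale vector_space_def cscale_def \<tau>_def
        trace_def sum_2 algebra_simps add_divide_distrib vec_eq_iff)
  moreover have "\<tau> x \<in> \<real>\<^sub>\<ge>\<^sub>0" if "psd x" for x
    using psd_diag[OF that, of 1] psd_diag[OF that, of 2]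
    by (auto simp: \<tau>_def trace_def sum_2 complex_nonneg_Reals_iff)
  ultimately show ?thesis
    by (simp add: state_def \<tau>_def trace_def sum_2 mat_def)
qed

(* The supremum in Bnorm is a genuine one. *)
lemma Bnorm_bdd: "bdd_above ((\<lambda>f. onorm (\<lambda>v. Bmat b f *v v)) ` S)"
proof (rule bdd_aboveI2)
  fix f assume "f \<in> S"
  then have "(norm f)\<^sup>2 \<le> 1"
    by (simp add: S_def norm_vec_def L2_set_def sum_3)
  then have nf: "\<bar>f $ k\<bar> \<le> 1" for k
    using component_le_norm_cart[of f k] by (simp add: power_le_one_iff abs_square_le_1)
  have "onorm (\<lambda>v. Bmat b f *v v) \<le> (\<Sum>i\<in>UNIV. \<Sum>j\<in>UNIV. \<bar>Bmat b f $ i $ j\<bar>)"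
    by (rule onorm_le_matrix_component_sum)
  also have "\<dots> \<le> (\<Sum>i\<in>UNIV. \<Sum>j\<in>UNIV. \<Sum>k\<in>UNIV. \<bar>b k i j\<bar>)"
  proof (intro sum_mono)
    fix i j
    have "\<bar>Bmat b f $ i $ j\<bar> \<le> (\<Sum>k\<in>UNIV. \<bar>b k i j * f $ k\<bar>)"
      by (simp add: Bmat_def sum_abs)
    also have "\<dots> \<le> (\<Sum>k\<in>UNIV. \<bar>b k i j\<bar>)"
      using nf by (intro sum_mono) (simp add: abs_mult mult_left_le)
    finally show "\<bar>Bmat b f $ i $ j\<bar> \<le> (\<Sum>k\<in>UNIV. \<bar>b k i j\<bar>)" .
  qed
  finally show "onorm (\<lambda>v. Bmat b f *v v) \<le> (\<Sum>i\<in>UNIV. \<Sum>j\<in>UNIV. \<Sum>k\<in>UNIV. \<bar>b k i j\<bar>)" .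
qed

end

theory Submission
  imports Defs
begin

text \<open>The vectors \<open>v \<in> \<complex>\<^sup>2\<close> represent, through their Bloch vectors
  \<open>f\<^sub>m = \<langle>v, \<sigma>\<^sub>m v\<rangle>\<close>, all of \<open>\<real>\<^sup>3\<close>, and \<open>\<parallel>f\<parallel> = \<parallel>v\<parallel>\<^sup>2\<close>. Hence
  \<open>\<parallel>w\<parallel> \<one> - w \<cdot> \<sigma> \<ge> 0\<close>, and testing the positive operator
  \<open>\<Delta> (\<parallel>w\<parallel> \<one> - w \<cdot> \<sigma>)\<close> on a product vector \<open>v \<otimes> u\<close> with Bloch vectors \<open>f\<close>, \<open>g\<close>
  gives \<open>\<Sum> b\<^bsub>ml,j\<^esub> f\<^sub>m g\<^sub>l w\<^sub>j \<le> \<parallel>f\<parallel> \<parallel>g\<parallel> \<parallel>w\<parallel>\<close>. Choosing \<open>g = \<bbbB>(f) w\<close>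
  yields the norm bound. The coefficients exist because \<open>\<Delta> \<sigma>\<^sub>j\<close> is Hermitian and both of
  its partial traces vanish.\<close>

definition quad :: "complex^'n^'n \<Rightarrow> complex^'n \<Rightarrow> complex" where
  "quad A v = (\<Sum>i\<in>UNIV. cnj (v $ i) * (A *v v) $ i)"

lemma quad_alt: "quad A v = (\<Sum>i\<in>UNIV. \<Sum>j\<in>UNIV. cnj (v $ i) * A $ i $ j * v $ j)"
  by (simp add: quad_def matrix_vector_mult_def sum_distrib_left mult.assoc)

lemma quad_add: "quad (A + B) v = quad A v + quad B v"
  by (simp add: quad_alt algebra_simps sum.distrib)

lemma quad_cscale: "quad (cscale c A) v = c * quad A v"
  by (simp add: quad_alt cscale_def sum_distrib_left mult_ac)

lemma quad_sum: "finite I \<Longrightarrow> quad (\<Sum>i\<in>I. A i) v = (\<Sum>i\<in>I. quad (A i) v)"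
  by (induction I rule: finite_induct) (simp_all add: quad_add, simp add: quad_alt)

lemma quad_mat_1: "quad (mat 1) v = of_real ((norm v)\<^sup>2)"
  by (simp add: quad_def norm_vec_def L2_set_def sum_nonneg complex_norm_square mult.commute del: of_real_power)

lemma psd_iff_quad: "psd A \<longleftrightarrow> (\<forall>v. quad A v \<in> \<real>\<^sub>\<ge>\<^sub>0)"
  by (simp add: psd_def quad_def)

definition tensor_vec :: "complex^'n \<Rightarrow> complex^'m \<Rightarrow> complex^('n \<times> 'm)" where
  "tensor_vec v u = (\<chi> i. v $ fst i * u $ snd i)"

lemma sum_UNIV_prod:
  "(\<Sum>p\<in>(UNIV :: ('a::finite \<times> 'b::finite) set). f p) = (\<Sum>i\<in>UNIV. \<Sum>j\<in>UNIV. f (i, j))"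
  by (simp add: sum.cartesian_product)

lemma quad_kron: "quad (kron A B) (tensor_vec v u) = quad A v * quad B u"
proof -
  have "quad (kron A B) (tensor_vec v u) =
    (\<Sum>i\<in>UNIV. \<Sum>k\<in>UNIV. \<Sum>j\<in>UNIV. \<Sum>l\<in>UNIV.
      (cnj (v $ i) * A $ i $ j * v $ j) * (cnj (u $ k) * B $ k $ l * u $ l))"
    by (simp add: quad_alt kron_def tensor_vec_def sum_UNIV_prod mult_ac)
  also have "\<dots> = quad A v * quad B u"
    by (simp add: quad_alt sum_product)
  finally show ?thesis .
qed

text \<open>Polarization: the form is real at \<open>axis i 1 + axis j c\<close>. With real diagonal
  entries, c = 1 makes the imaginary parts of the two off-diagonal entries opposite, and c = \<i>
  makes their real parts equal.\<close>

lemma psd_hermitian: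
  assumes "psd A"
  shows "A $ j $ i = cnj (A $ i $ j)"
proof (cases "i = j")
  case True
  then show ?thesis
    using psd_diag[OF assms, of i] by (auto simp: complex_eq_iff complex_nonneg_Reals_iff)
next
  case False
  have q: "quad A (axis i 1 + axis j c) =
      A $ i $ i + A $ i $ j * c + cnj c * A $ j $ i + cnj c * A $ j $ j * c" for c
  proof -
    have row: "(A *v (axis i 1 + axis j c)) $ k = A $ k $ i + A $ k $ j * c" for k
      unfolding matrix_vector_right_distrib
      by (simp add: matrix_vector_mult_def axis_def if_distrib if_distribR cong: if_cong)
    have "quad A (axis i 1 + axis j c) =
        (\<Sum>k\<in>UNIV. (if k = i then A $ k $ i + A $ k $ j * c else 0) +
           (if k = j then cnj c * (A $ k $ i + A $ k $ j * c) else 0))"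
      unfolding quad_def row using False by (intro sum.cong) (auto simp: axis_def)
    then show ?thesis
      by (simp add: sum.distrib algebra_simps)
  qed
  have "Im (quad A (axis i 1 + axis j c)) = 0" for c
    using assms by (simp add: psd_iff_quad complex_nonneg_Reals_iff)
  from this[of 1] this[of \<i>] psd_diag[OF assms, of i] psd_diag[OF assms, of j]
  show ?thesis
    by (simp add: q complex_eq_iff complex_nonneg_Reals_iff)
qed

text \<open>\<open>Re\<close> only changes the type, since the Pauli matrices are Hermitian. The
  vector v is not normalized, so that Bloch vectors of every length occur.\<close>

definition bloch :: "complex^2 \<Rightarrow> real^3" where
  "bloch v = (\<chi> m. Re (quad (pauli m) v))"

lemma pauli_nth:
  "pauli 1 $ 1 $ 1 = 0" "pauli 1 $ 1 $ 2 = 1" "pauli 1 $ 2 $ 1 = 1" "pauli 1 $ 2 $ 2 = 0"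
  "pauli 2 $ 1 $ 1 = 0" "pauli 2 $ 1 $ 2 = - \<i>" "pauli 2 $ 2 $ 1 = \<i>" "pauli 2 $ 2 $ 2 = 0"
  "pauli 3 $ 1 $ 1 = 1" "pauli 3 $ 1 $ 2 = 0" "pauli 3 $ 2 $ 1 = 0" "pauli 3 $ 2 $ 2 = - 1"
  by (simp_all add: pauli_def vector_2)

lemma quad_pauli: "quad (pauli m) v = of_real (bloch v $ m)"
proof -
  have "\<forall>m. Im (quad (pauli m) v) = 0"
    by (simp add: forall_3 quad_alt sum_2 pauli_nth algebra_simps)
  then show ?thesis
    by (simp add: bloch_def complex_eq_iff)
qed

lemma bloch_nth:
  "bloch v $ 1 = 2 * (Re (v $ 1) * Re (v $ 2) + Im (v $ 1) * Im (v $ 2))"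
  "bloch v $ 2 = 2 * (Re (v $ 1) * Im (v $ 2) - Im (v $ 1) * Re (v $ 2))"
  "bloch v $ 3 = (Re (v $ 1))\<^sup>2 + (Im (v $ 1))\<^sup>2 - (Re (v $ 2))\<^sup>2 - (Im (v $ 2))\<^sup>2"
  by (simp_all add: bloch_def quad_alt sum_2 pauli_nth power2_eq_square algebra_simps)

text \<open>The first two coordinates are the real and imaginary part of 2 cnj(v_1) v_2, and the
  third is |v_1|^2 - |v_2|^2; the identity (x - y)^2 + 4xy = (x + y)^2 does the rest.\<close>

lemma norm_bloch: "norm (bloch v) = (norm v)\<^sup>2"
proof -
  have v: "(norm v)\<^sup>2 = (Re (v $ 1))\<^sup>2 + (Im (v $ 1))\<^sup>2 + (Re (v $ 2))\<^sup>2 + (Im (v $ 2))\<^sup>2"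
    by (simp add: norm_vec_def L2_set_def sum_2 sum_nonneg cmod_def)
  have "(norm (bloch v))\<^sup>2 = ((norm v)\<^sup>2)\<^sup>2"
    unfolding v
    by (simp add: norm_vec_def L2_set_def sum_3 bloch_nth) (simp add: power2_eq_square algebra_simps)
  then show ?thesis
    by (metis norm_ge_zero power2_eq_iff_nonneg zero_le_power2)
qed

lemma bloch_surj: "\<exists>v. bloch v = f"
proof -
  define n where "n = norm f"
  have n2: "n\<^sup>2 = (f $ 1)\<^sup>2 + (f $ 2)\<^sup>2 + (f $ 3)\<^sup>2"
    by (simp add: n_def norm_vec_def L2_set_def sum_3)
  have "n \<ge> 0" and f3: "\<bar>f $ 3\<bar> \<le> n"
    by (simp_all add: n_def component_le_norm_cart)
  \<comment> \<open>The phase of v is fixed by taking v_1 = a real. Then a^2 + |v_2|^2 = n and a^2 -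
    |v_2|^2 = f_3 determine a, and 2 a v_2 = f_1 + \<i> f_2 determines v_2 unless a = 0.\<close>
  define a where "a = sqrt ((n + f $ 3) / 2)"
  have a2: "a\<^sup>2 = (n + f $ 3) / 2"
    using f3 by (simp add: a_def)
  show ?thesis
  proof (cases "a = 0")
    \<comment> \<open>Here f lies on the nonpositive third axis, and any v_2 of modulus
      \<open>sqrt n\<close> will do.\<close>
    case True
    with a2 have "f $ 3 = - n" by simp
    with n2 have "f $ 1 = 0" "f $ 2 = 0"
      by (simp_all add: sum_power2_eq_zero_iff)
    with \<open>f $ 3 = - n\<close> \<open>n \<ge> 0\<close>
    have "bloch (vector [0, of_real (sqrt n)]) = f"
      by (simp add: vec_eq_iff forall_3 bloch_nth)
    then show ?thesis by blast
  next
    case False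
    \<comment> \<open>Both sides equal n^2 - f_3^2; dividing by 4 a^2 gives the third
      coordinate.\<close>
    have "4 * a\<^sup>2 * (a\<^sup>2 - f $ 3) = (f $ 1)\<^sup>2 + (f $ 2)\<^sup>2"
      using n2 by (simp add: a2) (simp add: power2_eq_square algebra_simps)
    with False have "a\<^sup>2 - (f $ 1 / (2 * a))\<^sup>2 - (f $ 2 / (2 * a))\<^sup>2 = f $ 3"
      by (simp add: power_divide field_simps power2_eq_square)
    with False
    have "bloch (vector [of_real a, Complex (f $ 1 / (2 * a)) (f $ 2 / (2 * a))]) = f"
      by (simp add: vec_eq_iff forall_3 bloch_nth)
    then show ?thesis by blast
  qed
qed

definition pauli_comb :: "real^3 \<Rightarrow> m2" where
  "pauli_comb w = (\<Sum>j\<in>UNIV. cscale (of_real (w $ j)) (pauli j))"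

lemma quad_pauli_comb: "quad (pauli_comb w) v = of_real (w \<bullet> bloch v)"
  by (simp add: pauli_comb_def quad_sum quad_cscale quad_pauli inner_vec_def)

text \<open>By \<open>norm_bloch\<close>, nonnegativity of the quadratic form is the Cauchy-Schwarz
  inequality for w and \<open>bloch v\<close>.\<close>

lemma psd_norm_plus_pauli_comb: "psd (cscale (of_real (norm w)) (mat 1) + pauli_comb w)"
proof -
  have "norm w * (norm v)\<^sup>2 + w \<bullet> bloch v \<ge> 0" for v
    using Cauchy_Schwarz_ineq2[of w "bloch v"] by (simp add: norm_bloch)
  then show ?thesis
    by (simp add: psd_iff_quad quad_add quad_cscale quad_pauli_comb quad_mat_1
        complex_nonneg_Reals_iff flip: of_real_mult of_real_add of_real_power)
qed

lemma pauli_trilinear_bound: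
  assumes "qqo \<Delta>" and "pauli_form \<Delta> b"
  shows "(\<Sum>j\<in>UNIV. \<Sum>m\<in>UNIV. \<Sum>l\<in>UNIV. b m l j * f $ m * g $ l * w $ j)
    \<le> norm f * norm g * norm w"
proof -
  interpret Vector_Spaces.linear cscale cscale \<Delta>
    using assms(1) by (simp add: qqo_def)
  obtain v u where f: "f = bloch v" and g: "g = bloch u"
    using bloch_surj by metis
  \<comment> \<open>The sign of w is reversed so that nonnegativity bounds the trilinear form from
    above.\<close>
  define X where "X = cscale (of_real (norm (- w))) (mat 1) + pauli_comb (- w)"
  have "psd (\<Delta> X)"
    using assms(1) psd_norm_plus_pauli_comb[of "- w"] by (simp add: qqo_def X_def)
  then have nonneg: "quad (\<Delta> X) (tensor_vec v u) \<in> \<real>\<^sub>\<ge>\<^sub>0"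
    by (simp add: psd_iff_quad)
  have "\<Delta> X = cscale (of_real (norm w)) (kron (mat 1) (mat 1)) +
      (\<Sum>j\<in>UNIV. cscale (of_real ((- w) $ j)) (\<Sum>m\<in>UNIV. \<Sum>l\<in>UNIV.
        cscale (of_real (b m l j)) (kron (pauli m) (pauli l))))"
    using assms by (simp add: X_def pauli_comb_def add sum scale qqo_def pauli_form_def
        del: of_real_minus vector_uminus_component)
  then have "quad (\<Delta> X) (tensor_vec v u) = of_real (norm w * (norm f * norm g) +
      (\<Sum>j\<in>UNIV. (- w) $ j * (\<Sum>m\<in>UNIV. \<Sum>l\<in>UNIV. b m l j * (f $ m * g $ l))))"
    by (simp add: quad_add quad_sum quad_cscale quad_kron quad_mat_1 quad_pauli f g norm_bloch
        del: vector_uminus_component)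
  with nonneg have "0 \<le> norm w * (norm f * norm g) +
      (\<Sum>j\<in>UNIV. (- w) $ j * (\<Sum>m\<in>UNIV. \<Sum>l\<in>UNIV. b m l j * (f $ m * g $ l)))"
    by (simp only: complex_nonneg_Reals_iff Re_complex_of_real)
  then show ?thesis
    by (simp add: sum_distrib_left sum_negf mult_ac)
qed

lemma Bnorm_le_1:
  assumes "qqo \<Delta>" and "pauli_form \<Delta> b"
  shows "Bnorm b \<le> 1"
  unfolding Bnorm_def
proof (rule cSUP_least)
  show "S \<noteq> {}"
    by (auto simp: S_def intro!: exI[of _ 0])
next
  fix f assume "f \<in> S"
  then have f: "norm f \<le> 1"
    by (simp add: S_def norm_vec_def L2_set_def sum_3)
  show "onorm (\<lambda>v. Bmat b f *v v) \<le> 1"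
  proof (rule onorm_le)
    fix w
    define g where "g = Bmat b f *v w"
    \<comment> \<open>Only the second factor is unfolded; the first stays as the argument g of the
      trilinear form.\<close>
    have "g \<bullet> g = (\<Sum>l\<in>UNIV. g $ l * (\<Sum>j\<in>UNIV. (\<Sum>m\<in>UNIV. b m l j * f $ m) * w $ j))"
      by (subst (2) g_def) (simp add: inner_vec_def Bmat_def matrix_vector_mult_def)
    also have "\<dots> = (\<Sum>j\<in>UNIV. \<Sum>m\<in>UNIV. \<Sum>l\<in>UNIV. b m l j * f $ m * g $ l * w $ j)"
      by (simp add: sum_3 algebra_simps)
    also have "\<dots> \<le> norm f * norm g * norm w"
      by (rule pauli_trilinear_bound[OF assms])
    also have "\<dots> \<le> norm g * norm w"
      using f by (simp add: mult_left_le_one_le mult_right_mono)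
    finally have "norm g * norm g \<le> norm g * norm w"
      by (simp add: power2_norm_eq_inner flip: power2_eq_square)
    \<comment> \<open>Cancelling \<open>norm g\<close> needs it to be nonzero; otherwise the left
      side is 0.\<close>
    then show "norm (Bmat b f *v w) \<le> 1 * norm w"
      unfolding g_def[symmetric] by (cases "norm g = 0") (simp_all add: mult_le_cancel_left)
  qed
qed

text \<open>In the basis of products of the identity and the Pauli matrices, vanishing partial
  traces remove the seven terms with an identity factor, and Hermiticity makes the other nine
  coefficients real.\<close>

lemma hermitian_pauli_expansion:
  fixes X :: m2m2
  assumes herm: "\<And>p q. X $ q $ p = cnj (X $ p $ q)"
    and "slice1 \<tau> X = 0" and "slice2 \<tau> X = 0"
  shows "\<exists>c. X = (\<Sum>m\<in>UNIV. \<Sum>l\<in>UNIV. cscale (complex_of_real (c m l)) (kron (pauli m) (pauli l)))"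
proof -
  have s1: "X $ (2, k) $ (2, l) = - X $ (1, k) $ (1, l)" for k l
    using assms(2) by (simp add: slice1_def \<tau>_def trace_def unit_mat_def sum_2 cscale_def vec_eq_iff
        eq_neg_iff_add_eq_0 add.commute flip: add_divide_distrib)
  have s2: "X $ (k, 2) $ (l, 2) = - X $ (k, 1) $ (l, 1)" for k l
    using assms(3) by (simp add: slice2_def \<tau>_def trace_def unit_mat_def sum_2 cscale_def vec_eq_iff
        eq_neg_iff_add_eq_0 add.commute flip: add_divide_distrib)
  \<comment> \<open>The trace of X times the Pauli product, divided by 4: distinct products are
    trace-orthogonal, and each has a square of trace 4.\<close>
  define c where "c m l = Re (\<Sum>p\<in>UNIV. \<Sum>q\<in>UNIV. X $ p $ q * kron (pauli m) (pauli l) $ q $ p) / 4" for m l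
  have "X $ (i, k) $ (j, l) = (\<Sum>m\<in>UNIV. \<Sum>n\<in>UNIV. complex_of_real (c m n) * (pauli m $ i $ j * pauli n $ k $ l))"
    for i k j l
  proof -
    \<comment> \<open>Together with \<open>s1\<close>, \<open>s2\<close> and \<open>im\<close>,
      these relations reduce all sixteen entries to one real and four complex ones, nine real
      parameters to match the nine coefficients.\<close>
    note h = herm[of "(1,1)" "(1,2)"] herm[of "(1,1)" "(2,1)"] herm[of "(1,1)" "(2,2)"] herm[of "(1,2)" "(2,1)"]
    have im: "Im (X $ (1,1) $ (1,1)) = 0"
      using herm[of "(1,1)" "(1,1)"] by (simp add: complex_eq_iff)
    have "\<forall>i k j l. X $ (i, k) $ (j, l) = (\<Sum>m\<in>UNIV. \<Sum>n\<in>UNIV. complex_of_real (c m n) * (pauli m $ i $ j * pauli n $ k $ l))"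
      unfolding forall_2
      by (simp add: c_def sum_2 sum_3 sum_UNIV_prod kron_def pauli_nth s1 s2 h im complex_eq_iff)
        (simp add: field_simps)
    then show ?thesis by blast
  qed
  then have "X = (\<Sum>m\<in>UNIV. \<Sum>l\<in>UNIV. cscale (complex_of_real (c m l)) (kron (pauli m) (pauli l)))"
    by (simp add: vec_eq_iff cscale_def kron_def)
  then show ?thesis by blast
qed

lemma pauli_form_exists:
  assumes "qqo \<Delta>" and "haar_state \<tau> \<Delta>"
  shows "\<exists>b. pauli_form \<Delta> b"
proof -
  interpret Vector_Spaces.linear cscale cscale \<Delta>
    using assms(1) by (simp add: qqo_def)
  have "\<exists>c. \<Delta> (pauli j) = (\<Sum>m\<in>UNIV. \<Sum>l\<in>UNIV.
      cscale (complex_of_real (c m l)) (kron (pauli m) (pauli l)))" for j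
  proof (rule hermitian_pauli_expansion)
    have comb: "pauli_comb (axis j 1) = pauli j"
      by (simp add: pauli_comb_def axis_def vec_eq_iff cscale_def if_distrib if_distribR cong: if_cong)
    \<comment> \<open>A Pauli matrix is not positive, so positivity of \<Delta> is applied after
      adding the identity, whose image is Hermitian and can be subtracted again.\<close>
    have "psd (mat 1 + pauli j)"
      using psd_norm_plus_pauli_comb[of "axis j 1"] by (simp add: comb cscale_def)
    then have psd: "psd (kron (mat 1) (mat 1) + \<Delta> (pauli j))"
      using assms(1) by (metis add qqo_def)
    show "\<Delta> (pauli j) $ q $ p = cnj (\<Delta> (pauli j) $ p $ q)" for p q
    proof -
      have "kron (mat 1) (mat 1) $ q $ p = cnj ((kron (mat 1) (mat 1) :: m2m2) $ p $ q)"
        by (auto simp: kron_def mat_def)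
      with psd_hermitian[OF psd, of q p] show ?thesis
        by (simp only: vector_add_component complex_cnj_add add_left_cancel)
    qed
    \<comment> \<open>The Haar property turns tracelessness into the vanishing of both partial
      traces.\<close>
    have "\<forall>j. \<tau> (pauli j) = 0"
      by (simp add: forall_3 \<tau>_def trace_def sum_2 pauli_nth)
    then show "slice1 \<tau> (\<Delta> (pauli j)) = 0" "slice2 \<tau> (\<Delta> (pauli j)) = 0"
      using assms(2) by (simp_all add: haar_state_def cscale_def vec_eq_iff)
  qed
  then have "\<exists>c. \<forall>j. \<Delta> (pauli j) = (\<Sum>m\<in>UNIV. \<Sum>l\<in>UNIV.
      cscale (complex_of_real (c j m l)) (kron (pauli m) (pauli l)))"
    by (intro choice allI)
  then obtain c where "\<forall>j. \<Delta> (pauli j) = (\<Sum>m\<in>UNIV. \<Sum>l\<in>UNIV.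
      cscale (complex_of_real (c j m l)) (kron (pauli m) (pauli l)))" ..
  then show ?thesis
    by (intro exI[of _ "\<lambda>m l j. c j m l"]) (simp add: pauli_form_def)
qed

text \<open>The existence part ensures that the bound for every coefficient family b is not
  vacuous.\<close>

theorem proposition3p3:
  fixes \<Delta> :: "m2 \<Rightarrow> m2m2"
  assumes "qqo \<Delta>" and "haar_state \<tau> \<Delta>"
  shows "(\<exists>b. pauli_form \<Delta> b) \<and> (\<forall>b. pauli_form \<Delta> b \<longrightarrow> Bnorm b \<le> 1)"
  using pauli_form_exists[OF assms] Bnorm_le_1[OF assms(1)] by blast

end
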